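(* Let $(M,d)$ be a compact metric space, let $\mu$ be a Borel probability measure on $M$, and let $k:M\times M\to[0,\infty)$ satisfy $k(p,q)=k(q,p)$ for all $p,q\in M$ and, for some $L>0$, $|k(p,s)-k(q,s)|\le L\,d(p,q)$ for all $p,q,s\in M$. Fix $b>0$. For Borel measurable $f\ge 0$ with $\int_M f\,d\mu=1$ define $$U[f](p)=\int_M k(p,q)f(q)\,d\mu(q),\qquad \mathcal{E}_b[f]=\int_M\Big\{\log f+\frac b2 U[f]\Big\}f\,d\mu .$$ Then there exists a Borel measurable function $g\ge 0$ with $\int_M g\,d\mu=1$ such that $$\mathcal{E}_b[g]=\min_{f\ge 0,\ \int_M f\,d\mu=1}\mathcal{E}_b[f].$$ Moreover, $g$ is strictly positive, Lipschitz continuous, and solves the Onsager equation $$g=\big(Z_b[g]\big)^{-1}e^{-bU[g]},\qquad Z_b[g]=\int_M e^{-bU[g](p)}\,d\mu(p).$$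
   Context: The convention $0\log 0=0$ is used in the free energy $\mathcal{E}_b$. *)

theory Defs
  imports "HOL-Probability.Probability"
begin

definition xlogx :: "real \<Rightarrow> real" where
  "xlogx x = (if x = 0 then 0 else x * ln x)"

definition admissible :: "'a measure \<Rightarrow> ('a \<Rightarrow> real) \<Rightarrow> bool" where
  "admissible \<mu> f \<longleftrightarrow> f \<in> borel_measurable \<mu> \<and> (\<forall>x. 0 \<le> f x)
      \<and> (\<integral>\<^sup>+ x. ennreal (f x) \<partial>\<mu>) = 1"

definition potU :: "'a measure \<Rightarrow> ('a \<Rightarrow> 'a \<Rightarrow> real) \<Rightarrow> ('a \<Rightarrow> real) \<Rightarrow> 'a \<Rightarrow> real" where
  "potU \<mu> k f p = (\<integral> q. k p q * f q \<partial>\<mu>)"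

definition energy_density ::
  "'a measure \<Rightarrow> ('a \<Rightarrow> 'a \<Rightarrow> real) \<Rightarrow> real \<Rightarrow> ('a \<Rightarrow> real) \<Rightarrow> 'a \<Rightarrow> real" where
  "energy_density \<mu> k b f q = xlogx (f q) + b / 2 * potU \<mu> k f q * f q"

text \<open>Free energy E_b[f] as an extended real: the Lebesgue integral of the
  integrand, defined as integral of positive part minus integral of negative part
  (the negative part is always finite here, so the value lies in (-inf, +inf]).\<close>
definition free_energy ::
  "'a measure \<Rightarrow> ('a \<Rightarrow> 'a \<Rightarrow> real) \<Rightarrow> real \<Rightarrow> ('a \<Rightarrow> real) \<Rightarrow> ereal" where
  "free_energy \<mu> k b f =
     enn2ereal (\<integral>\<^sup>+ q. ennreal (energy_density \<mu> k b f q) \<partial>\<mu>)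
   - enn2ereal (\<integral>\<^sup>+ q. ennreal (- energy_density \<mu> k b f q) \<partial>\<mu>)"

definition partition_fn ::
  "'a measure \<Rightarrow> ('a \<Rightarrow> 'a \<Rightarrow> real) \<Rightarrow> real \<Rightarrow> ('a \<Rightarrow> real) \<Rightarrow> real" where
  "partition_fn \<mu> k b g = (\<integral> p. exp (- b * potU \<mu> k g p) \<partial>\<mu>)"

end

theory Submission
  imports Defs "HOL-Complex_Analysis.Great_Picard"
begin

text \<open>The interaction term is a compact perturbation of the entropy, so the direct method needs no
  weak compactness in \<open>L\<^sup>1\<close>. If \<open>f\<close> nearly minimises the energy, moving from \<open>f\<close> a short way towards
  the Gibbs density \<open>h\<close> of the frozen potential \<open>U[f]\<close> shows that \<open>f\<close> nearly minimises the free energy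
  in that potential; as \<open>h\<close> is its exact minimiser, a quantitative Gibbs inequality makes \<open>f - h\<close>
  small in \<open>L\<^sup>1\<close>, so \<open>h\<close> has almost the same energy. Potentials of probability densities are bounded
  and equi-Lipschitz, so a minimising sequence of Gibbs densities converges pointwise along a
  subsequence. Applied to an exact minimiser \<open>g\<close>, the same estimate gives \<open>g = h\<close> almost everywhere,
  and \<open>h\<close> solves the Onsager equation everywhere.\<close>

section \<open>Inequalities for the entropy density \<open>xlogx\<close>\<close>

text \<open>The remainder comes from \<open>(sqrt x - sqrt m)\<^sup>2\<close>; keeping \<open>t\<close> free makes it linear in \<open>\<bar>x - m\<bar>\<close>, so that
  integrating and optimising over \<open>t\<close> replaces Cauchy--Schwarz.\<close>
lemma xlogx_tangent_bound:
  assumes "0 \<le> x" "0 < m"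
  shows "xlogx m + (1 + ln m) * (x - m) + 2 * t * \<bar>x - m\<bar> - 2 * t\<^sup>2 * (x + m) \<le> xlogx x"
proof -
  define a c where "a = sqrt x" and "c = sqrt m"
  have ac: "0 \<le> a" "0 < c" "x = a\<^sup>2" "m = c\<^sup>2"
    using assms by (auto simp: a_def c_def)
  \<comment> \<open>From \<open>ln y \<le> y - 1\<close> at \<open>y = c / a\<close>. Subtracting
    \<open>x - m\<close> from both sides shows that the relative entropy density dominates the
    Hellinger term \<open>(a - c)\<^sup>2\<close>.\<close>
  have log: "2 * x - 2 * a * c \<le> xlogx x - x * ln m"
  proof (cases "x = 0")
    case False
    then have a: "a > 0" using ac by auto
    have "ln (c / a) \<le> c / a - 1"
      using a ac by (intro ln_le_minus_one) auto
    then have "ln c - ln a \<le> c / a - 1"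
      using a ac by (simp add: ln_div)
    then have "2 * a\<^sup>2 * (ln c - ln a) \<le> 2 * a\<^sup>2 * (c / a - 1)"
      by (intro mult_left_mono) auto
    also have "\<dots> = 2 * a * c - 2 * a\<^sup>2"
      using a by (simp add: field_simps power2_eq_square)
    finally show ?thesis
      using False a ac by (simp add: xlogx_def ln_realpow algebra_simps)
  qed (use ac in \<open>simp add: xlogx_def\<close>)
  have "\<bar>x - m\<bar> = \<bar>a - c\<bar> * (a + c)"
  proof -
    have "x - m = (a - c) * (a + c)"
      using ac by (simp add: power2_eq_square algebra_simps)
    then show ?thesis
      using ac by (simp add: abs_mult)
  qed
  then have "2 * t * \<bar>x - m\<bar> \<le> (a - c)\<^sup>2 + t\<^sup>2 * (a + c)\<^sup>2"
    using zero_le_power2[of "\<bar>a - c\<bar> - t * (a + c)"]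
    by (simp add: power2_diff[of "\<bar>a - c\<bar>"] power_mult_distrib mult_ac)
  also have "\<dots> \<le> (a - c)\<^sup>2 + t\<^sup>2 * (2 * (x + m))"
  proof -
    have "(a + c)\<^sup>2 \<le> 2 * (x + m)"
      using ac zero_le_power2[of "a - c"] by (simp add: power2_eq_square algebra_simps)
    then show ?thesis
      by (simp add: mult_left_mono)
  qed
  finally have "2 * t * \<bar>x - m\<bar> - 2 * t\<^sup>2 * (x + m) \<le> x + m - 2 * a * c"
    using ac by (simp add: power2_eq_square algebra_simps)
  with log assms show ?thesis
    by (simp add: xlogx_def algebra_simps)
qed

text \<open>The tangent at \<open>1\<close>. Its consequence \<open>-1 \<le> xlogx x\<close> keeps
  the negative part of the free energy finite.\<close>

lemma xlogx_ge: "0 \<le> x \<Longrightarrow> x - 1 \<le> xlogx x"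
  using xlogx_tangent_bound[of x 1 0] by (simp add: xlogx_def)

text \<open>The tangents at the mean \<open>m\<close> are averaged with weights \<open>1 - s\<close>
  and \<open>s\<close>, and their slope terms cancel. At \<open>m = 0\<close> there is no tangent,
  but both weighted arguments vanish.\<close>

lemma xlogx_convex:
  assumes "0 \<le> x" "0 \<le> y" "0 \<le> s" "s \<le> 1"
  shows "xlogx ((1 - s) * x + s * y) \<le> (1 - s) * xlogx x + s * xlogx y"
proof -
  define m where "m = (1 - s) * x + s * y"
  have nonneg: "0 \<le> m" "0 \<le> (1 - s) * x" "0 \<le> s * y"
    using assms by (auto simp: m_def)
  show ?thesis
  proof (cases "m = 0")
    case True
    then have "(1 - s) * x = 0" "s * y = 0"
      using nonneg unfolding m_def by linarith+
    then show ?thesis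
      by (auto simp: xlogx_def)
  next
    case False
    with nonneg have "0 < m" by simp
    then have "(1 - s) * (xlogx m + (1 + ln m) * (x - m)) + s * (xlogx m + (1 + ln m) * (y - m))
        \<le> (1 - s) * xlogx x + s * xlogx y"
      using xlogx_tangent_bound[of x m 0] xlogx_tangent_bound[of y m 0] assms
      by (intro add_mono mult_left_mono) auto
    also have "(1 - s) * (xlogx m + (1 + ln m) * (x - m)) + s * (xlogx m + (1 + ln m) * (y - m))
        = xlogx m + (1 + ln m) * ((1 - s) * x + s * y - m)"
      by (simp add: algebra_simps)
    finally show ?thesis
      by (simp add: m_def)
  qed
qed

lemma borel_measurable_xlogx [measurable]: "xlogx \<in> borel_measurable borel"
  unfolding xlogx_def by measurable

lemma abs_integral_le:
  fixes f g :: "'a \<Rightarrow> real"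
  assumes "integrable M f" "integrable M g" "\<And>x. \<bar>f x\<bar> \<le> g x"
  shows "\<bar>\<integral>x. f x \<partial>M\<bar> \<le> (\<integral>x. g x \<partial>M)"
  by (rule order_trans[OF integral_abs_bound integral_mono]) (use assms in auto)

section \<open>The compact space, its kernel and the functionals\<close>

locale onsager = prob_space \<mu> for \<mu> :: "'a::metric_space measure" +
  fixes k :: "'a \<Rightarrow> 'a \<Rightarrow> real" and L b :: real
  assumes compactM: "compact (UNIV :: 'a set)"
    and borel: "sets \<mu> = sets borel"
    and k_nonneg: "\<And>p q. 0 \<le> k p q"
    and k_sym: "\<And>p q. k p q = k q p"
    and L_pos: "L > 0"
    and k_lip: "\<And>p q s. \<bar>k p s - k q s\<bar> \<le> L * dist p q"
    and b_pos: "b > 0"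
begin

abbreviation U :: "('a \<Rightarrow> real) \<Rightarrow> 'a \<Rightarrow> real" where "U \<equiv> potU \<mu> k"

definition K :: real where "K = (SUP x. case_prod k x)"

text \<open>A Bochner integral, hence \<open>0\<close> when the entropy density is not integrable;
  it represents the entropy only under \<open>finent\<close>.\<close>

definition ent :: "('a \<Rightarrow> real) \<Rightarrow> real" where "ent f = (\<integral>x. xlogx (f x) \<partial>\<mu>)"

definition Q :: "('a \<Rightarrow> real) \<Rightarrow> ('a \<Rightarrow> real) \<Rightarrow> real" where
  "Q u v = (\<integral>p. U u p * v p \<partial>\<mu>)"

definition energy :: "('a \<Rightarrow> real) \<Rightarrow> real" where "energy f = ent f + b / 2 * Q f f"

text \<open>By \<open>free_energy_eq\<close> these are exactly the admissible densities of finite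
  free energy.\<close>

definition finent :: "('a \<Rightarrow> real) \<Rightarrow> bool" where
  "finent f \<longleftrightarrow> admissible \<mu> f \<and> integrable \<mu> (\<lambda>x. xlogx (f x))"

text \<open>The argument is a potential rather than a density, because limits of sequences of
  potentials also have to be inserted.\<close>

definition gibbs :: "('a \<Rightarrow> real) \<Rightarrow> 'a \<Rightarrow> real" where
  "gibbs u p = exp (- b * u p) / (\<integral>q. exp (- b * u q) \<partial>\<mu>)"

lemma space_UNIV [simp]: "space \<mu> = UNIV"
  using sets_eq_imp_space_eq[OF borel] by simp

lemma prob_UNIV [simp]: "prob UNIV = 1"
  using prob_space by simp

lemma continuous_measurable: "continuous_on UNIV f \<Longrightarrow> (f :: 'a \<Rightarrow> real) \<in> borel_measurable \<mu>"
  using borel_measurable_continuous_onI borel measurable_cong_sets by blast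

lemma k_lip2: "\<bar>k p q - k p q'\<bar> \<le> L * dist q q'"
  using k_lip[of q p q'] by (simp add: k_sym)

lemma k_measurable [measurable]: "k p \<in> borel_measurable \<mu>"
proof -
  have "L-lipschitz_on UNIV (k p)"
    using k_lip2 L_pos by (auto intro!: lipschitz_onI simp: dist_real_def)
  then show ?thesis
    by (intro continuous_measurable lipschitz_on_continuous_on)
qed

text \<open>Compactness bounds all distances from \<open>p\<close> by some \<open>e\<close>; two
  Lipschitz moves, one in each argument, then lead from \<open>(x, y)\<close> to
  \<open>(p, p)\<close>.\<close>

lemma k_le_K: "k p q \<le> K"
proof -
  have "bounded (UNIV :: 'a set)"
    using compactM compact_imp_bounded by blast
  then obtain e where e: "\<And>q. dist (p::'a) q \<le> e"
    using bounded_any_center[of UNIV p] by auto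
  have Le: "L * dist p q \<le> L * e" for q
    using e L_pos by (intro mult_left_mono) auto
  have "k x y \<le> k p p + 2 * (L * e)" for x y
  proof -
    have "k x y \<le> k p y + L * e" "k p y \<le> k p p + L * e"
      using k_lip[of x y p] k_lip2[of p y p] Le[of x] Le[of y]
      by (auto simp: dist_commute abs_le_iff)
    then show ?thesis by simp
  qed
  then have "bdd_above (range (case_prod k))"
    by (auto intro!: bdd_aboveI)
  then show ?thesis
    unfolding K_def using cSUP_upper[of "(p, q)" UNIV "case_prod k"] by simp
qed

lemma K_nonneg: "0 \<le> K"
  using k_nonneg[of undefined undefined] k_le_K[of undefined undefined] by linarith

text \<open>Enumerates the centres of finite covers by balls of radius \<open>1 / (n + 1)\<close>.
  The sequence serves to discretise the first argument of \<open>k\<close> and to extract convergent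
  subsequences of potentials.\<close>

lemma dense_sequence: "\<exists>d :: nat \<Rightarrow> 'a. \<forall>e>0. \<forall>x. \<exists>i. dist x (d i) < e"
proof -
  have "\<exists>F. finite F \<and> UNIV \<subseteq> (\<Union>x\<in>F. ball (x::'a) (inverse (Suc n)))" for n
    using compactM unfolding compact_eq_totally_bounded by (metis inverse_positive_iff_positive of_nat_0_less_iff zero_less_Suc)
  then obtain F where F: "\<And>n. finite (F n)" "\<And>n. UNIV \<subseteq> (\<Union>x\<in>F n. ball (x::'a) (inverse (Suc n)))"
    by metis
  define A where "A = (\<Union>n. F n)"
  have "countable A"
    unfolding A_def using F(1) by (auto intro: countable_finite)
  moreover have "A \<noteq> {}"
    using F(2) unfolding A_def by blast
  ultimately have rng: "range (from_nat_into A) = A"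
    by (simp add: range_from_nat_into)
  have "\<exists>i. dist x (from_nat_into A i) < e" if "0 < e" for x e
  proof -
    obtain n where n: "inverse (real (Suc n)) < e"
      using reals_Archimedean \<open>0 < e\<close> by blast
    have "x \<in> (\<Union>y\<in>F n. ball y (inverse (real (Suc n))))"
      using F(2) by blast
    then obtain y where "y \<in> F n" "dist y x < inverse (real (Suc n))"
      by auto
    then show ?thesis
      using n rng unfolding A_def by (metis UN_I UNIV_I dist_commute less_trans rangeE)
  qed
  then show ?thesis
    by blast
qed

text \<open>Continuity of \<open>k\<close> alone does not give this: without a type class for second countability,
  the product of the Borel algebras is not known to be the Borel algebra of the product.\<close>
lemma k_pair_measurable [measurable]: "(\<lambda>(p, q). k p q) \<in> borel_measurable (\<mu> \<Otimes>\<^sub>M \<mu>)"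
proof -
  obtain d :: "nat \<Rightarrow> 'a" where d: "\<And>e x. 0 < e \<Longrightarrow> \<exists>i. dist x (d i) < e"
    using dense_sequence by metis
  \<comment> \<open>The first index whose point lies within \<open>1 / (n + 1)\<close> of
    \<open>x\<close>. Replacing \<open>p\<close> by \<open>d (i n p)\<close> splits the kernel into
    countably many measurable pieces and changes it by at most \<open>L / (n + 1)\<close>.\<close>
  define i where "i n x = (LEAST j. dist x (d j) < inverse (real (Suc n)))" for n x
  have i: "dist x (d (i n x)) < inverse (real (Suc n))" for n x
    unfolding i_def by (rule LeastI_ex) (simp add: d)
  have [measurable]: "i n \<in> \<mu> \<rightarrow>\<^sub>M count_space UNIV" for n
  proof -
    have [measurable]: "(\<lambda>x. dist x (d j)) \<in> borel_measurable \<mu>" for j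
      by (intro continuous_measurable continuous_intros)
    show ?thesis
      unfolding i_def by measurable
  qed
  show ?thesis
  proof (rule borel_measurable_LIMSEQ_real)
    fix x assume "x \<in> space (\<mu> \<Otimes>\<^sub>M \<mu>)"
    show "(\<lambda>n. k (d (i n (fst x))) (snd x)) \<longlonglongrightarrow> (case x of (p, q) \<Rightarrow> k p q)"
    proof (rule LIM_zero_cancel, rule Lim_null_comparison)
      show "\<forall>\<^sub>F n in sequentially. norm (k (d (i n (fst x))) (snd x) - (case x of (p, q) \<Rightarrow> k p q))
          \<le> L * inverse (real (Suc n))"
      proof (rule always_eventually, rule allI)
        fix n
        have "norm (k (d (i n (fst x))) (snd x) - (case x of (p, q) \<Rightarrow> k p q))
          \<le> L * dist (d (i n (fst x))) (fst x)"
          using k_lip by (simp add: case_prod_beta)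
        also have "\<dots> \<le> L * inverse (real (Suc n))"
          using i[of "fst x" n] L_pos by (intro mult_left_mono) (auto simp: dist_commute)
        finally show "norm (k (d (i n (fst x))) (snd x) - (case x of (p, q) \<Rightarrow> k p q))
          \<le> L * inverse (real (Suc n))" .
      qed
      show "(\<lambda>n. L * inverse (real (Suc n))) \<longlonglongrightarrow> 0"
        using tendsto_mult[OF tendsto_const LIMSEQ_inverse_real_of_nat] by simp
    qed
  next
    show "(\<lambda>x. k (d (i n (fst x))) (snd x)) \<in> borel_measurable (\<mu> \<Otimes>\<^sub>M \<mu>)" for n
      by (rule measurable_compose_countable[where f="\<lambda>j x. k (d j) (snd x)"]) measurable
  qed
qed

section \<open>Potentials and the quadratic interaction\<close>

lemma kernel_integrable: "integrable \<mu> v \<Longrightarrow> integrable \<mu> (\<lambda>q. k p q * v q)"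
  by (rule Bochner_Integration.integrable_bound[where f="\<lambda>q. K * v q"])
    (auto simp: abs_mult k_nonneg k_le_K mult_right_mono K_nonneg)

text \<open>The constant depends on \<open>v\<close> only through its L1 norm, so the potentials of
  all probability densities share the constant \<open>L\<close>.\<close>

lemma potU_lipschitz:
  assumes "integrable \<mu> v"
  shows "\<bar>U v p - U v q\<bar> \<le> L * (\<integral>x. \<bar>v x\<bar> \<partial>\<mu>) * dist p q"
proof -
  have "U v p - U v q = (\<integral>x. (k p x - k q x) * v x \<partial>\<mu>)"
    unfolding potU_def using assms by (simp add: kernel_integrable left_diff_distrib)
  also have "\<bar>\<dots>\<bar> \<le> (\<integral>x. L * dist p q * \<bar>v x\<bar> \<partial>\<mu>)"
    using assms kernel_integrable[OF assms]
    by (intro abs_integral_le)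
      (auto simp: abs_mult intro!: mult_right_mono k_lip, simp add: left_diff_distrib)
  finally show ?thesis
    by (simp add: mult_ac)
qed

lemma potU_measurable [measurable]:
  assumes "integrable \<mu> v"
  shows "U v \<in> borel_measurable \<mu>"
proof (rule continuous_measurable, rule lipschitz_on_continuous_on)
  show "(L * (\<integral>x. \<bar>v x\<bar> \<partial>\<mu>))-lipschitz_on UNIV (U v)"
    using potU_lipschitz[OF assms] L_pos
    by (auto intro!: lipschitz_onI simp: dist_real_def)
qed

lemma potU_abs_le:
  assumes "integrable \<mu> v"
  shows "\<bar>U v p\<bar> \<le> K * (\<integral>x. \<bar>v x\<bar> \<partial>\<mu>)"
proof -
  have "\<bar>U v p\<bar> \<le> (\<integral>x. K * \<bar>v x\<bar> \<partial>\<mu>)"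
    unfolding potU_def using assms kernel_integrable[OF assms]
    by (intro abs_integral_le)
      (auto simp: abs_mult k_nonneg intro!: mult_right_mono k_le_K)
  then show ?thesis
    by simp
qed

text \<open>Integration ignores null sets; this upgrades an almost everywhere identity of densities
  to an identity of potentials at every point.\<close>

lemma potU_cong_AE:
  assumes "AE x in \<mu>. u x = v x" "u \<in> borel_measurable \<mu>" "v \<in> borel_measurable \<mu>"
  shows "U u = U v"
  unfolding potU_def using assms by (intro ext integral_cong_AE) auto

lemma bounded_mult_integrable:
  fixes v w :: "'a \<Rightarrow> real"
  assumes "integrable \<mu> v" "w \<in> borel_measurable \<mu>" "\<And>p. \<bar>w p\<bar> \<le> c"
  shows "integrable \<mu> (\<lambda>p. w p * v p)"
proof (rule Bochner_Integration.integrable_bound[where f="\<lambda>q. c * v q"])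
  have "\<bar>w p\<bar> * \<bar>v p\<bar> \<le> \<bar>c\<bar> * \<bar>v p\<bar>" for p
    using assms(3)[of p] by (intro mult_right_mono) auto
  then show "AE p in \<mu>. norm (w p * v p) \<le> norm (c * v p)"
    by (simp add: abs_mult)
qed (use assms in auto)

lemma potU_mult_integrable:
  "integrable \<mu> u \<Longrightarrow> integrable \<mu> v \<Longrightarrow> integrable \<mu> (\<lambda>p. U u p * v p)"
  using bounded_mult_integrable potU_measurable potU_abs_le by blast

text \<open>Fubini and the symmetry of \<open>k\<close>; the double integrand is dominated by
  \<open>K\<close> times the integrable product of \<open>u\<close> and \<open>v\<close>.\<close>

lemma Q_sym:
  assumes [measurable]: "integrable \<mu> u" "integrable \<mu> v"
  shows "Q u v = Q v u"
proof -
  interpret pair_sigma_finite \<mu> \<mu> ..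
  have [measurable]: "u \<in> borel_measurable \<mu>" "v \<in> borel_measurable \<mu>"
    using assms by auto
  have "integrable (\<mu> \<Otimes>\<^sub>M \<mu>) (\<lambda>x. u (fst x) * v (snd x))"
  proof -
    have "integrable (\<mu> \<Otimes>\<^sub>M \<mu>) (\<lambda>(x, y). u x * v y)"
      using assms by (intro Fubini_integrable) (auto simp: abs_mult)
    then show ?thesis by (simp add: case_prod_beta')
  qed
  then have "integrable (\<mu> \<Otimes>\<^sub>M \<mu>) (\<lambda>(p, q). k p q * (u p * v q))"
    by (rule Bochner_Integration.integrable_bound
        [where f="\<lambda>x. K * (u (fst x) * v (snd x))", OF integrable_mult_right])
      (measurable, auto simp: abs_mult k_nonneg K_nonneg intro!: mult_right_mono k_le_K AE_I2)
  from Fubini_integral[OF this]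
  have "(\<integral>q. (\<integral>p. k p q * (u p * v q) \<partial>\<mu>) \<partial>\<mu>) = (\<integral>p. (\<integral>q. k p q * (u p * v q) \<partial>\<mu>) \<partial>\<mu>)" .
  moreover have "(\<integral>q. (\<integral>p. k p q * (u p * v q) \<partial>\<mu>) \<partial>\<mu>) = Q u v"
  proof -
    have "(\<integral>p. k p q * (u p * v q) \<partial>\<mu>) = U u q * v q" for q
      unfolding potU_def by (simp add: k_sym[of _ q] flip: mult.assoc)
    then show ?thesis by (simp add: Q_def)
  qed
  moreover have "(\<integral>p. (\<integral>q. k p q * (u p * v q) \<partial>\<mu>) \<partial>\<mu>) = Q v u"
  proof -
    have "(\<integral>q. k p q * (u p * v q) \<partial>\<mu>) = U v p * u p" for p
      unfolding potU_def by (simp add: mult.left_commute[of _ "u p"] mult.commute[of _ "u p"])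
    then show ?thesis by (simp add: Q_def)
  qed
  ultimately show ?thesis by simp
qed

lemma potU_lincomb:
  assumes "integrable \<mu> u" "integrable \<mu> v"
  shows "U (\<lambda>x. c * u x + d * v x) p = c * U u p + d * U v p"
proof -
  have "U (\<lambda>x. c * u x + d * v x) p = (\<integral>x. c * (k p x * u x) + d * (k p x * v x) \<partial>\<mu>)"
    unfolding potU_def by (simp add: algebra_simps)
  then show ?thesis
    unfolding potU_def using assms by (simp add: kernel_integrable)
qed

lemma Q_lincomb:
  assumes "integrable \<mu> u" "integrable \<mu> v"
  shows "Q (\<lambda>x. c * u x + d * v x) (\<lambda>x. c * u x + d * v x)
    = c\<^sup>2 * Q u u + 2 * c * d * Q u v + d\<^sup>2 * Q v v"
proof -
  note int = potU_mult_integrable[OF assms(1) assms(1)] potU_mult_integrable[OF assms(1) assms(2)]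
    potU_mult_integrable[OF assms(2) assms(1)] potU_mult_integrable[OF assms(2) assms(2)]
  have "Q (\<lambda>x. c * u x + d * v x) (\<lambda>x. c * u x + d * v x)
    = (\<integral>p. c\<^sup>2 * (U u p * u p) + c * d * (U u p * v p) + c * d * (U v p * u p) + d\<^sup>2 * (U v p * v p) \<partial>\<mu>)"
    unfolding Q_def by (simp add: potU_lincomb[OF assms] algebra_simps power2_eq_square)
  also have "\<dots> = c\<^sup>2 * Q u u + c * d * Q u v + c * d * Q v u + d\<^sup>2 * Q v v"
    unfolding Q_def using int by simp
  finally show ?thesis
    using Q_sym[OF assms] by simp
qed

text \<open>The left side is \<open>Q w w\<close> for \<open>w = u - v\<close>, and
  \<open>U w\<close> is at most \<open>K\<close> times the L1 norm of \<open>w\<close>. Linearising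
  the interaction thus costs only second order in the L1 distance.\<close>

lemma Q_diff_le:
  assumes "integrable \<mu> u" "integrable \<mu> v"
  shows "Q u u - 2 * Q u v + Q v v \<le> K * (\<integral>x. \<bar>u x - v x\<bar> \<partial>\<mu>)\<^sup>2"
proof -
  define w where "w x = u x - v x" for x
  have w: "integrable \<mu> w"
    unfolding w_def using assms by simp
  have "Q w w \<le> (\<integral>p. K * (\<integral>x. \<bar>w x\<bar> \<partial>\<mu>) * \<bar>w p\<bar> \<partial>\<mu>)"
    unfolding Q_def
  proof (rule integral_mono)
    fix p
    have "U w p * w p \<le> \<bar>U w p\<bar> * \<bar>w p\<bar>"
      by (metis abs_ge_self abs_mult)
    also have "\<dots> \<le> K * (\<integral>x. \<bar>w x\<bar> \<partial>\<mu>) * \<bar>w p\<bar>"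
      by (intro mult_right_mono potU_abs_le w) auto
    finally show "U w p * w p \<le> K * (\<integral>x. \<bar>w x\<bar> \<partial>\<mu>) * \<bar>w p\<bar>" .
  qed (use w potU_mult_integrable in auto)
  then show ?thesis
    using Q_lincomb[OF assms, of 1 "-1"] by (simp add: w_def [abs_def] power2_eq_square mult.assoc)
qed

section \<open>Admissible densities and the free energy\<close>

lemma admissible_iff:
  "admissible \<mu> f \<longleftrightarrow> integrable \<mu> f \<and> (\<forall>x. 0 \<le> f x) \<and> (\<integral>x. f x \<partial>\<mu>) = 1"
proof
  assume "admissible \<mu> f"
  then have f: "f \<in> borel_measurable \<mu>" "\<forall>x. 0 \<le> f x" "(\<integral>\<^sup>+x. f x \<partial>\<mu>) = 1"
    by (auto simp: admissible_def)
  then have "integrable \<mu> f"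
    by (intro integrableI_nonneg) auto
  moreover have "(\<integral>x. f x \<partial>\<mu>) = 1"
    using f by (simp add: integral_eq_nn_integral)
  ultimately show "integrable \<mu> f \<and> (\<forall>x. 0 \<le> f x) \<and> (\<integral>x. f x \<partial>\<mu>) = 1"
    using f by simp
next
  assume "integrable \<mu> f \<and> (\<forall>x. 0 \<le> f x) \<and> (\<integral>x. f x \<partial>\<mu>) = 1"
  then show "admissible \<mu> f"
    by (auto simp: admissible_def nn_integral_eq_integral)
qed

lemma admissibleD:
  assumes "admissible \<mu> f"
  shows "integrable \<mu> f" "f \<in> borel_measurable \<mu>" "0 \<le> f x" "(\<integral>x. f x \<partial>\<mu>) = 1"
  using assms by (auto simp: admissible_iff)

lemma l1_dist_le_2:
  assumes "admissible \<mu> f" "admissible \<mu> g"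
  shows "(\<integral>x. \<bar>f x - g x\<bar> \<partial>\<mu>) \<le> 2"
proof -
  have "(\<integral>x. \<bar>f x - g x\<bar> \<partial>\<mu>) \<le> (\<integral>x. f x + g x \<partial>\<mu>)"
  proof (rule integral_mono)
    show "\<bar>f x - g x\<bar> \<le> f x + g x" for x
      using admissibleD(3)[OF assms(1), of x] admissibleD(3)[OF assms(2), of x] by linarith
  qed (use admissibleD(1)[OF assms(1)] admissibleD(1)[OF assms(2)] in auto)
  also have "\<dots> = 2"
    using admissibleD[OF assms(1)] admissibleD[OF assms(2)] by simp
  finally show ?thesis .
qed

text \<open>Keeps the bounds of a potential without a density behind it: the class contains
  \<open>U f\<close> for admissible \<open>f\<close> and is closed under pointwise limits of
  sequences.\<close>

definition potential :: "('a \<Rightarrow> real) \<Rightarrow> bool" where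
  "potential u \<longleftrightarrow> u \<in> borel_measurable \<mu> \<and> (\<forall>p. 0 \<le> u p \<and> u p \<le> K)"

lemma potentialD:
  assumes "potential u"
  shows "u \<in> borel_measurable \<mu>" "0 \<le> u p" "u p \<le> K" "\<bar>u p\<bar> \<le> K"
  using assms by (auto simp: potential_def)

lemma potU_nonneg:
  assumes "admissible \<mu> f"
  shows "0 \<le> U f p"
  unfolding potU_def using admissibleD(3)[OF assms] k_nonneg by (intro integral_nonneg_AE) auto

lemma potential_potU:
  assumes "admissible \<mu> f"
  shows "potential (U f)"
  using potU_measurable[OF admissibleD(1)[OF assms]] potU_nonneg[OF assms]
    potU_abs_le[OF admissibleD(1)[OF assms]] admissibleD(3,4)[OF assms]
  by (simp add: potential_def)

lemma finent_admissible: "finent f \<Longrightarrow> admissible \<mu> f"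
  by (simp add: finent_def)

text \<open>Integrate \<open>x - 1 \<le> xlogx x\<close>: for a probability density the left side
  has mean \<open>0\<close>.\<close>

lemma ent_nonneg:
  assumes "finent f"
  shows "0 \<le> ent f"
proof -
  have "(\<integral>x. f x - 1 \<partial>\<mu>) \<le> ent f"
    unfolding ent_def
  proof (rule integral_mono)
    show "f x - 1 \<le> xlogx (f x)" for x
      using xlogx_ge assms admissibleD(3) finent_admissible by blast
  qed (use assms admissibleD(1)[OF finent_admissible[OF assms]] in \<open>auto simp: finent_def\<close>)
  then show ?thesis
    using admissibleD[OF finent_admissible[OF assms]] by simp
qed

lemma Q_nonneg:
  assumes "admissible \<mu> f" "admissible \<mu> g"
  shows "0 \<le> Q f g"
  unfolding Q_def using admissibleD(3)[OF assms(2)] potU_nonneg[OF assms(1)]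
  by (intro integral_nonneg_AE) auto

lemma energy_nonneg: "finent f \<Longrightarrow> 0 \<le> energy f"
  unfolding energy_def using ent_nonneg Q_nonneg finent_admissible b_pos by simp

text \<open>Passes from the extended-real energy to the real one. The interaction term is always
  integrable, so finiteness is decided by the entropy alone.\<close>

lemma free_energy_eq:
  assumes f: "admissible \<mu> f"
  shows "free_energy \<mu> k b f = (if finent f then ereal (energy f) else \<infinity>)"
proof -
  let ?d = "energy_density \<mu> k b f"
  note [measurable] = admissibleD(2)[OF f] potU_measurable[OF admissibleD(1)[OF f]]
  have d_meas [measurable]: "?d \<in> borel_measurable \<mu>"
    unfolding energy_density_def by measurable
  have Uf: "integrable \<mu> (\<lambda>q. U f q * f q)"
    using potU_mult_integrable admissibleD(1)[OF f] by blast
  have "- 1 \<le> ?d q" for q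
  proof -
    have "0 \<le> b / 2 * U f q * f q"
      using b_pos potU_nonneg[OF f] admissibleD(3)[OF f] by simp
    then show ?thesis
      using xlogx_ge[OF admissibleD(3)[OF f, of q]] admissibleD(3)[OF f, of q]
      by (simp add: energy_density_def)
  qed
  then have "(\<integral>\<^sup>+q. ennreal (- ?d q) \<partial>\<mu>) \<le> (\<integral>\<^sup>+q. 1 \<partial>\<mu>)"
    by (intro nn_integral_mono) (simp add: minus_le_iff)
  then have neg: "(\<integral>\<^sup>+q. ennreal (- ?d q) \<partial>\<mu>) < \<infinity>"
    using emeasure_space_1 by (auto simp: le_less_trans[OF _ ennreal_one_less_top])
  have int_iff: "integrable \<mu> ?d \<longleftrightarrow> finent f"
  proof
    assume "integrable \<mu> ?d"
    then have "integrable \<mu> (\<lambda>q. ?d q - b / 2 * (U f q * f q))"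
      using Uf by simp
    then show "finent f"
      using f by (simp add: finent_def energy_density_def)
  next
    assume "finent f"
    then have "integrable \<mu> (\<lambda>q. xlogx (f q) + b / 2 * (U f q * f q))"
      using Uf by (simp add: finent_def)
    then show "integrable \<mu> ?d"
      by (simp add: energy_density_def [abs_def] mult.assoc)
  qed
  show ?thesis
  proof (cases "finent f")
    case True
    then have d: "integrable \<mu> ?d"
      by (simp add: int_iff)
    have "(\<integral>q. ?d q \<partial>\<mu>) = energy f"
      using True Uf by (simp add: energy_density_def finent_def energy_def ent_def Q_def mult.assoc)
    moreover have "free_energy \<mu> k b f = ereal (\<integral>q. ?d q \<partial>\<mu>)"
    proof -
      obtain r where r: "0 \<le> r" "(\<integral>\<^sup>+q. ennreal (?d q) \<partial>\<mu>) = ennreal r"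
        using d by (cases "\<integral>\<^sup>+q. ennreal (?d q) \<partial>\<mu>") (auto simp: real_integrable_def)
      moreover obtain s where s: "0 \<le> s" "(\<integral>\<^sup>+q. ennreal (- ?d q) \<partial>\<mu>) = ennreal s"
        using d by (cases "\<integral>\<^sup>+q. ennreal (- ?d q) \<partial>\<mu>") (auto simp: real_integrable_def)
      ultimately show ?thesis
        using real_lebesgue_integral_def[OF d] by (simp add: free_energy_def)
    qed
    ultimately show ?thesis
      using True by simp
  next
    case False
    \<comment> \<open>The energy density is not integrable although its negative part has finite
      integral, so the positive part must have infinite integral.\<close>
    then have "(\<integral>\<^sup>+q. ennreal (?d q) \<partial>\<mu>) = \<infinity>"
      using neg d_meas int_iff by (auto simp: real_integrable_def)
    moreover obtain s where "0 \<le> s" "(\<integral>\<^sup>+q. ennreal (- ?d q) \<partial>\<mu>) = ennreal s"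
      using neg by (cases "\<integral>\<^sup>+q. ennreal (- ?d q) \<partial>\<mu>") auto
    ultimately show ?thesis
      using False by (simp add: free_energy_def)
  qed
qed

section \<open>Gibbs densities and their variational inequality\<close>

definition Z :: "('a \<Rightarrow> real) \<Rightarrow> real" where "Z u = (\<integral>q. exp (- b * u q) \<partial>\<mu>)"

lemma weight_bounds:
  assumes "potential u"
  shows "exp (- b * K) \<le> exp (- b * u p)" "exp (- b * u p) \<le> 1"
  using potentialD(2,3)[OF assms, of p] b_pos by (auto simp: mult_left_mono)

lemma weight_integrable:
  assumes "potential u"
  shows "integrable \<mu> (\<lambda>p. exp (- b * u p))"
  using weight_bounds[OF assms] potentialD(1)[OF assms]
  by (intro integrable_const_bound[where B=1]) auto

lemma Z_bounds:
  assumes "potential u"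
  shows "exp (- b * K) \<le> Z u" "Z u \<le> 1"
proof -
  have "(\<integral>p. exp (- b * K) \<partial>\<mu>) \<le> Z u" "Z u \<le> (\<integral>p. 1 \<partial>\<mu>)"
    unfolding Z_def using weight_bounds[OF assms] weight_integrable[OF assms]
    by (intro integral_mono; auto)+
  then show "exp (- b * K) \<le> Z u" "Z u \<le> 1"
    by simp_all
qed

lemma Z_pos: "potential u \<Longrightarrow> 0 < Z u"
  using Z_bounds(1)[of u] exp_gt_zero[of "- b * K"] by linarith

lemma gibbs_eq: "gibbs u p = exp (- b * u p) / Z u"
  by (simp add: gibbs_def Z_def)

lemma gibbs_pos: "potential u \<Longrightarrow> 0 < gibbs u p"
  by (simp add: gibbs_eq Z_pos)

lemma ln_gibbs: "potential u \<Longrightarrow> ln (gibbs u p) = - b * u p - ln (Z u)"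
  using Z_pos[of u] by (simp add: gibbs_eq ln_div)

text \<open>\<open>- b * u p\<close> lies between \<open>- b * K\<close> and \<open>0\<close>, and
  \<open>- ln (Z u)\<close> between \<open>0\<close> and \<open>b * K\<close>; the opposite signs
  keep the bound at \<open>b * K\<close>. Being uniform in \<open>u\<close>, it supplies constant
  majorants for limits.\<close>

lemma abs_ln_gibbs_le:
  assumes "potential u"
  shows "\<bar>ln (gibbs u p)\<bar> \<le> b * K"
proof -
  have "- b * K \<le> ln (Z u)"
    using Z_bounds(1)[OF assms] Z_pos[OF assms] by (metis exp_gt_zero ln_exp ln_le_cancel_iff)
  moreover have "ln (Z u) \<le> 0"
    using Z_bounds(2)[OF assms] Z_pos[OF assms] by simp
  moreover have "0 \<le> b * u p" "b * u p \<le> b * K"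
    using potentialD(2,3)[OF assms] b_pos by (auto simp: mult_left_mono)
  ultimately show ?thesis
    by (auto simp: ln_gibbs[OF assms] abs_le_iff)
qed

lemma gibbs_le:
  assumes "potential u"
  shows "gibbs u p \<le> exp (b * K)"
  using abs_ln_gibbs_le[OF assms, of p] gibbs_pos[OF assms, of p]
  by (metis abs_le_D1 exp_le_cancel_iff exp_ln)

lemma gibbs_measurable [measurable]:
  assumes "potential u"
  shows "gibbs u \<in> borel_measurable \<mu>"
proof -
  note [measurable] = potentialD(1)[OF assms]
  show ?thesis unfolding gibbs_def by measurable
qed

lemma abs_xlogx_gibbs_le:
  assumes "potential u"
  shows "\<bar>xlogx (gibbs u p)\<bar> \<le> exp (b * K) * (b * K)"
  using gibbs_pos[OF assms, of p] gibbs_le[OF assms, of p] abs_ln_gibbs_le[OF assms, of p]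
  by (auto simp: xlogx_def abs_mult intro!: mult_mono)

lemma finent_gibbs:
  assumes "potential u"
  shows "finent (gibbs u)"
proof -
  note [measurable] = gibbs_measurable[OF assms]
  have "(\<integral>p. gibbs u p \<partial>\<mu>) = 1"
    using Z_pos[OF assms] by (simp add: gibbs_eq) (simp add: Z_def)
  moreover have "integrable \<mu> (gibbs u)"
    using gibbs_le[OF assms] gibbs_pos[OF assms]
    by (intro integrable_const_bound[where B="exp (b * K)"]) (auto simp: abs_of_pos)
  moreover have "integrable \<mu> (\<lambda>p. xlogx (gibbs u p))"
    using abs_xlogx_gibbs_le[OF assms]
    by (intro integrable_const_bound[where B="exp (b * K) * (b * K)"]) auto
  ultimately show ?thesis
    using gibbs_pos[OF assms] by (simp add: finent_def admissible_iff less_imp_le)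
qed

text \<open>At \<open>gibbs u\<close> the tangent slope is \<open>1 - ln (Z u) - b * u x\<close>.
  Its constant part drops out since both densities have mass \<open>1\<close>, and the rest is the
  potential term. The terms in \<open>t\<close> give a Pinsker-type gain.\<close>

lemma gibbs_variational:
  assumes u: "potential u" and f: "finent f"
  shows "ent (gibbs u) + b * (\<integral>x. u x * gibbs u x \<partial>\<mu>)
      + 2 * t * (\<integral>x. \<bar>f x - gibbs u x\<bar> \<partial>\<mu>) - 4 * t\<^sup>2
    \<le> ent f + b * (\<integral>x. u x * f x \<partial>\<mu>)"
proof -
  let ?h = "gibbs u"
  note h = finent_gibbs[OF u]
  note fD = admissibleD[OF finent_admissible[OF f]]
  note hD = admissibleD[OF finent_admissible[OF h]]
  have int: "integrable \<mu> (\<lambda>x. xlogx (f x))" "integrable \<mu> (\<lambda>x. xlogx (?h x))"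
    "integrable \<mu> (\<lambda>x. u x * f x)" "integrable \<mu> (\<lambda>x. u x * ?h x)"
    using f h bounded_mult_integrable[OF _ potentialD(1,4)[OF u]] fD hD
    by (auto simp: finent_def)
  have "(\<integral>x. (xlogx (?h x) + b * (u x * ?h x)) + (1 - ln (Z u)) * (f x - ?h x)
      + 2 * t * \<bar>f x - ?h x\<bar> - 2 * t\<^sup>2 * (f x + ?h x) \<partial>\<mu>)
    \<le> (\<integral>x. xlogx (f x) + b * (u x * f x) \<partial>\<mu>)"
  proof (rule integral_mono)
    show "(xlogx (?h x) + b * (u x * ?h x)) + (1 - ln (Z u)) * (f x - ?h x)
      + 2 * t * \<bar>f x - ?h x\<bar> - 2 * t\<^sup>2 * (f x + ?h x) \<le> xlogx (f x) + b * (u x * f x)" for x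
      using xlogx_tangent_bound[OF fD(3)[of x] gibbs_pos[OF u, of x], of t]
      by (simp add: ln_gibbs[OF u] algebra_simps)
  qed (use int fD hD in auto)
  then show ?thesis
    using int fD hD by (simp add: ent_def)
qed

section \<open>Near-minimisers are close to their Gibbs densities\<close>

text \<open>The accuracy \<open>\<delta>\<^sup>2\<close> matches a step of length
  \<open>\<delta>\<close>: after division by \<open>\<delta>\<close> the error is still linear in
  \<open>\<delta>\<close>.\<close>

lemma near_minimizer:
  assumes f: "finent f" and near: "\<And>f'. finent f' \<Longrightarrow> energy f \<le> energy f' + \<delta>\<^sup>2"
    and \<delta>: "0 < \<delta>" "\<delta> \<le> 1"
  defines "D \<equiv> \<integral>x. \<bar>f x - gibbs (U f) x\<bar> \<partial>\<mu>"
  shows "D\<^sup>2 \<le> 4 * (1 + 2 * b * K) * \<delta>"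
    and "energy (gibbs (U f)) \<le> energy f + b / 2 * K * D\<^sup>2"
proof -
  define h where "h = gibbs (U f)"
  note fA = finent_admissible[OF f]
  note u = potential_potU[OF fA]
  have h: "finent h"
    unfolding h_def by (rule finent_gibbs[OF u])
  note hA = finent_admissible[OF h]
  note fD = admissibleD[OF fA] and hD = admissibleD[OF hA]
  have var: "ent h + b * Q f h + 2 * t * D - 4 * t\<^sup>2 \<le> ent f + b * Q f f" for t
    using gibbs_variational[OF u f] by (simp add: h_def D_def Q_def)
  define R where "R = Q f f - 2 * Q f h + Q h h"
  have R: "R \<le> K * D\<^sup>2"
    unfolding R_def D_def h_def[symmetric] by (rule Q_diff_le) (use fD hD in auto)
  have D: "0 \<le> D" "D \<le> 2"
    using l1_dist_le_2[OF fA hA] by (auto simp: D_def h_def)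
  have "b / 2 * R \<le> b / 2 * (K * D\<^sup>2)"
    using R b_pos by (intro mult_left_mono) auto
  then show "energy (gibbs (U f)) \<le> energy f + b / 2 * K * D\<^sup>2"
    using var[of 0] by (simp add: energy_def R_def h_def algebra_simps)
  \<comment> \<open>A step of length \<open>\<delta>\<close> gains \<open>\<delta>\<close> times the gap in the linearised energy at a cost \<open>O(\<delta>\<^sup>2)\<close>.\<close>
  define fs where "fs x = (1 - \<delta>) * f x + \<delta> * h x" for x
  have xl: "xlogx (fs x) \<le> (1 - \<delta>) * xlogx (f x) + \<delta> * xlogx (h x)" for x
    unfolding fs_def using fD hD \<delta> by (intro xlogx_convex) auto
  have fsA: "admissible \<mu> fs"
    unfolding admissible_iff fs_def using fD hD \<delta> by simp
  have fs: "finent fs"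
  proof -
    have "integrable \<mu> (\<lambda>x. xlogx (fs x))"
    proof (rule Bochner_Integration.integrable_bound)
      \<comment> \<open>Convexity bounds \<open>xlogx (fs x)\<close> from above and
        \<open>-1\<close> bounds it from below, whence the summand \<open>1\<close>.\<close>
      show "AE x in \<mu>. norm (xlogx (fs x)) \<le> norm (\<bar>xlogx (f x)\<bar> + \<bar>xlogx (h x)\<bar> + 1)"
      proof (rule AE_I2)
        fix x
        have "(1 - \<delta>) * xlogx (f x) \<le> 1 * \<bar>xlogx (f x)\<bar>" "\<delta> * xlogx (h x) \<le> 1 * \<bar>xlogx (h x)\<bar>"
          using \<delta> by (intro order_trans[OF mult_left_mono[OF abs_ge_self] mult_right_mono]; simp)+
        then show "norm (xlogx (fs x)) \<le> norm (\<bar>xlogx (f x)\<bar> + \<bar>xlogx (h x)\<bar> + 1)"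
          using xl[of x] xlogx_ge[OF admissibleD(3)[OF fsA, of x]] admissibleD(3)[OF fsA, of x]
          by simp
      qed
    qed (use f h admissibleD[OF fsA] in \<open>auto simp: finent_def\<close>)
    then show ?thesis
      using fsA by (simp add: finent_def)
  qed
  have ent_fs: "ent fs \<le> (1 - \<delta>) * ent f + \<delta> * ent h"
  proof -
    have "ent fs \<le> (\<integral>x. (1 - \<delta>) * xlogx (f x) + \<delta> * xlogx (h x) \<partial>\<mu>)"
      unfolding ent_def using fs f h xl by (intro integral_mono) (auto simp: finent_def)
    then show ?thesis
      using f h by (simp add: ent_def finent_def)
  qed
  have Q_fs: "Q fs fs = Q f f + 2 * \<delta> * (Q f h - Q f f) + \<delta>\<^sup>2 * R"
    unfolding fs_def Q_lincomb[OF fD(1) hD(1)] R_def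
    by (simp add: algebra_simps power2_eq_square)
  have "energy f \<le> energy fs + \<delta>\<^sup>2"
    by (rule near[OF fs])
  then have "\<delta> * (ent f + b * Q f f - ent h - b * Q f h) \<le> \<delta>\<^sup>2 + b / 2 * (\<delta>\<^sup>2 * R)"
    using ent_fs by (simp add: energy_def Q_fs algebra_simps)
  \<comment> \<open>\<open>D \<le> 2\<close> gives \<open>R \<le> 4 * K\<close>, the source of the
    constant \<open>1 + 2 * b * K\<close>.\<close>
  also have "\<dots> \<le> \<delta>\<^sup>2 + b / 2 * (\<delta>\<^sup>2 * (K * 2\<^sup>2))"
    using R K_nonneg D b_pos
    by (intro add_left_mono mult_left_mono order_trans[OF R] power_mono) auto
  also have "\<dots> = \<delta> * (\<delta> * (1 + 2 * b * K))"
    by (simp add: algebra_simps power2_eq_square)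
  finally have "ent f + b * Q f f - ent h - b * Q f h \<le> \<delta> * (1 + 2 * b * K)"
    using \<delta> by simp
  \<comment> \<open>\<open>t = D / 4\<close> maximises \<open>2 * t * D - 4 * t\<^sup>2\<close>,
    with value \<open>D\<^sup>2 / 4\<close>.\<close>
  with var[of "D / 4"] have "2 * (D / 4) * D - 4 * (D / 4)\<^sup>2 \<le> \<delta> * (1 + 2 * b * K)"
    by linarith
  then show "D\<^sup>2 \<le> 4 * (1 + 2 * b * K) * \<delta>"
    by (simp add: power2_eq_square field_simps)
qed

section \<open>Limits of potentials\<close>

text \<open>Dominated convergence, applied in turn to the normaliser, the entropy, the potential and
  the interaction, with constant majorants depending only on \<open>b\<close> and
  \<open>K\<close>.\<close>

lemma
  assumes u: "\<And>n. potential (u n)" and lim: "\<And>x. (\<lambda>n. u n x) \<longlonglongrightarrow> v x"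
  shows potential_lim: "potential v"
    and energy_gibbs_lim: "(\<lambda>n. energy (gibbs (u n))) \<longlonglongrightarrow> energy (gibbs v)"
proof -
  have "v \<in> borel_measurable \<mu>"
    by (rule borel_measurable_LIMSEQ_real[OF _ potentialD(1)[OF u]]) (use lim in auto)
  moreover have "0 \<le> v x" "v x \<le> K" for x
    using LIMSEQ_le_const[OF lim] LIMSEQ_le_const2[OF lim] potentialD[OF u] by blast+
  ultimately show v: "potential v"
    by (simp add: potential_def)
  note [measurable] = potentialD(1)[OF u] potentialD(1)[OF v]
    gibbs_measurable[OF u] gibbs_measurable[OF v]
  have Z: "(\<lambda>n. Z (u n)) \<longlonglongrightarrow> Z v"
    unfolding Z_def
  proof (rule integral_dominated_convergence[where w="\<lambda>_. 1"])
    show "AE x in \<mu>. (\<lambda>n. exp (- b * u n x)) \<longlonglongrightarrow> exp (- b * v x)"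
      by (intro AE_I2 tendsto_intros lim)
  qed (use weight_bounds(2)[OF u] in auto)
  have g: "(\<lambda>n. gibbs (u n) x) \<longlonglongrightarrow> gibbs v x" for x
    unfolding gibbs_eq using Z_pos[OF v] by (intro tendsto_intros lim Z) auto
  \<comment> \<open>The limit density is positive, so \<open>ln\<close> is continuous there.\<close>
  have xl: "(\<lambda>n. xlogx (gibbs (u n) x)) \<longlonglongrightarrow> xlogx (gibbs v x)" for x
  proof -
    have "(\<lambda>n. gibbs (u n) x * ln (gibbs (u n) x)) \<longlonglongrightarrow> gibbs v x * ln (gibbs v x)"
      using gibbs_pos[OF v, of x] by (intro tendsto_intros g) auto
    moreover have "xlogx (gibbs w x) = gibbs w x * ln (gibbs w x)" if "potential w" for w
      using gibbs_pos[OF that, of x] by (simp add: xlogx_def)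
    ultimately show ?thesis
      using u v by simp
  qed
  have ent: "(\<lambda>n. ent (gibbs (u n))) \<longlonglongrightarrow> ent (gibbs v)"
    unfolding ent_def
  proof (rule integral_dominated_convergence[where w="\<lambda>_. exp (b * K) * (b * K)"])
    show "AE x in \<mu>. (\<lambda>n. xlogx (gibbs (u n) x)) \<longlonglongrightarrow> xlogx (gibbs v x)"
      by (intro AE_I2 xl)
  qed (use abs_xlogx_gibbs_le[OF u] in auto)
  have U: "(\<lambda>n. U (gibbs (u n)) p) \<longlonglongrightarrow> U (gibbs v) p" for p
    unfolding potU_def
  proof (rule integral_dominated_convergence[where w="\<lambda>_. K * exp (b * K)"])
    show "AE x in \<mu>. (\<lambda>n. k p x * gibbs (u n) x) \<longlonglongrightarrow> k p x * gibbs v x"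
      by (intro AE_I2 tendsto_intros g)
    show "AE x in \<mu>. norm (k p x * gibbs (u n) x) \<le> K * exp (b * K)" for n
      using gibbs_pos[OF u] gibbs_le[OF u] k_nonneg k_le_K K_nonneg
      by (intro AE_I2) (auto simp: abs_mult abs_of_pos less_imp_le intro!: mult_mono)
  qed auto
  have pot: "potential (U (gibbs w))" if "potential w" for w
    using that by (intro potential_potU finent_admissible finent_gibbs)
  note [measurable] = potentialD(1)[OF pot[OF u]] potentialD(1)[OF pot[OF v]]
  have "(\<lambda>n. Q (gibbs (u n)) (gibbs (u n))) \<longlonglongrightarrow> Q (gibbs v) (gibbs v)"
    unfolding Q_def
  proof (rule integral_dominated_convergence[where w="\<lambda>_. K * exp (b * K)"])
    show "AE x in \<mu>. (\<lambda>n. U (gibbs (u n)) x * gibbs (u n) x) \<longlonglongrightarrow> U (gibbs v) x * gibbs v x"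
      by (intro AE_I2 tendsto_intros g U)
    show "AE x in \<mu>. norm (U (gibbs (u n)) x * gibbs (u n) x) \<le> K * exp (b * K)" for n
      using gibbs_pos[OF u] gibbs_le[OF u] potentialD(4)[OF pot[OF u]] K_nonneg
      by (intro AE_I2) (auto simp: abs_mult abs_of_pos less_imp_le intro!: mult_mono)
  qed auto
  then show "(\<lambda>n. energy (gibbs (u n))) \<longlonglongrightarrow> energy (gibbs v)"
    unfolding energy_def by (intro tendsto_intros ent)
qed

lemma potU_lip:
  assumes "admissible \<mu> f"
  shows "\<bar>U f p - U f q\<bar> \<le> L * dist p q"
  using potU_lipschitz[OF admissibleD(1)[OF assms], of p q] admissibleD[OF assms] by simp

text \<open>A pointwise Arzela-Ascoli argument: a diagonal subsequence converges on the dense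
  sequence, and the common Lipschitz constant carries the Cauchy property to every point.\<close>

lemma potentials_convergent_subsequence:
  assumes f: "\<And>n::nat. admissible \<mu> (f n)"
  obtains r v where "strict_mono (r :: nat \<Rightarrow> nat)" "\<And>x. (\<lambda>n. U (f (r n)) x) \<longlonglongrightarrow> v x"
proof -
  obtain d :: "nat \<Rightarrow> 'a" where d: "\<And>e x. 0 < e \<Longrightarrow> \<exists>i. dist x (d i) < e"
    using dense_sequence by metis
  obtain r where r: "strict_mono (r :: nat \<Rightarrow> nat)"
      "\<And>x. x \<in> range d \<Longrightarrow> \<exists>l. (\<lambda>n. U (f (r n)) x) \<longlonglongrightarrow> l"
    using function_convergent_subsequence[of "range d" "\<lambda>n. U (f n)" K]
      potentialD(4)[OF potential_potU[OF f]] by (metis countable_image countableI_type real_norm_def)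
  have "Cauchy (\<lambda>n. U (f (r n)) x)" for x
  proof (rule metric_CauchyI)
    fix e :: real assume "0 < e"
    then obtain i where i: "dist x (d i) < e / (3 * L)"
      using d[of "e / (3 * L)" x] L_pos by auto
    have near: "\<bar>U (f n) x - U (f n) (d i)\<bar> < e / 3" for n
    proof -
      have "L * dist x (d i) < e / 3"
        using i L_pos by (simp add: field_simps)
      then show ?thesis
        using potU_lip[OF f, of n x "d i"] by linarith
    qed
    have "Cauchy (\<lambda>n. U (f (r n)) (d i))"
      using r(2)[of "d i"] LIMSEQ_imp_Cauchy by blast
    then obtain N where N: "\<And>m n. N \<le> m \<Longrightarrow> N \<le> n \<Longrightarrow>
        dist (U (f (r m)) (d i)) (U (f (r n)) (d i)) < e / 3"
      using \<open>0 < e\<close> by (metis metric_CauchyD zero_less_divide_iff zero_less_numeral)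
    have "dist (U (f (r m)) x) (U (f (r n)) x) < e" if "N \<le> m" "N \<le> n" for m n
      using N[OF that] near[of "r m"] near[of "r n"] unfolding dist_real_def by linarith
    then show "\<exists>N. \<forall>m\<ge>N. \<forall>n\<ge>N. dist (U (f (r m)) x) (U (f (r n)) x) < e"
      by blast
  qed
  then have "\<forall>x. \<exists>l. (\<lambda>n. U (f (r n)) x) \<longlonglongrightarrow> l"
    by (simp add: Cauchy_convergent_iff convergent_def)
  then have "\<exists>v. \<forall>x. (\<lambda>n. U (f (r n)) x) \<longlonglongrightarrow> v x"
    by (rule choice)
  then show ?thesis
    using that r(1) by blast
qed

section \<open>Existence of a minimiser\<close>

text \<open>Only the potentials of the minimising sequence are made to converge; the minimiser is
  the Gibbs density of their limit \<open>v\<close>.\<close>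

lemma minimizer_exists:
  obtains g where "finent g" "\<And>f. finent f \<Longrightarrow> energy g \<le> energy f"
proof -
  define I where "I = Inf (energy ` Collect finent)"
  \<comment> \<open>The zero potential provides a density of finite entropy.\<close>
  have ne: "Collect finent \<noteq> {}"
    using finent_gibbs[of "\<lambda>_. 0"] K_nonneg by (auto simp: potential_def)
  have bdd: "bdd_below (energy ` Collect finent)"
    using energy_nonneg by (auto intro!: bdd_belowI)
  have I_le: "I \<le> energy f" if "finent f" for f
    unfolding I_def using that bdd by (intro cInf_lower) auto
  define \<delta> where "\<delta> n = inverse (real (Suc n))" for n
  have \<delta>: "0 < \<delta> n" "\<delta> n \<le> 1" for n
    by (auto simp: \<delta>_def field_simps)
  have "\<exists>f. finent f \<and> energy f < I + (\<delta> n)\<^sup>2" for n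
    using cInf_lessD[of "energy ` Collect finent" "I + (\<delta> n)\<^sup>2"] ne \<delta>[of n]
    by (auto simp: I_def)
  then obtain f where f: "\<And>n. finent (f n)" "\<And>n. energy (f n) < I + (\<delta> n)\<^sup>2"
    by metis
  obtain r v where r: "strict_mono r" and v: "\<And>x. (\<lambda>n. U (f (r n)) x) \<longlonglongrightarrow> v x"
    using potentials_convergent_subsequence[of f] finent_admissible[OF f(1)] by blast
  note u = potential_potU[OF finent_admissible[OF f(1)]]
  \<comment> \<open>Replacing \<open>f n\<close> by its Gibbs density keeps the sequence minimising,
    as every error term vanishes with \<open>\<delta> n\<close>.\<close>
  have "energy (gibbs (U (f n))) \<le> I + (\<delta> n)\<^sup>2 + b / 2 * K * (4 * (1 + 2 * b * K) * \<delta> n)" for n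
  proof -
    have near: "energy (f n) \<le> energy f' + (\<delta> n)\<^sup>2" if "finent f'" for f'
      using f(2)[of n] I_le[OF that] by linarith
    let ?D = "\<integral>x. \<bar>f n x - gibbs (U (f n)) x\<bar> \<partial>\<mu>"
    have "?D\<^sup>2 \<le> 4 * (1 + 2 * b * K) * \<delta> n"
      by (rule near_minimizer(1)[OF f(1) near \<delta>])
    then have "b / 2 * K * ?D\<^sup>2 \<le> b / 2 * K * (4 * (1 + 2 * b * K) * \<delta> n)"
      by (rule mult_left_mono) (use b_pos K_nonneg in simp)
    moreover have "energy (gibbs (U (f n))) \<le> energy (f n) + b / 2 * K * ?D\<^sup>2"
      by (rule near_minimizer(2)[OF f(1) near \<delta>])
    ultimately have "energy (gibbs (U (f n))) \<le> energy (f n) + b / 2 * K * (4 * (1 + 2 * b * K) * \<delta> n)"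
      by linarith
    then show ?thesis
      using f(2)[of n] by linarith
  qed
  moreover have "\<delta> \<longlonglongrightarrow> 0"
    unfolding \<delta>_def by (rule LIMSEQ_inverse_real_of_nat)
  then have "(\<lambda>n. \<delta> (r n)) \<longlonglongrightarrow> 0"
    using r LIMSEQ_subseq_LIMSEQ by (fastforce simp: o_def)
  then have "(\<lambda>n. I + (\<delta> (r n))\<^sup>2 + b / 2 * K * (4 * (1 + 2 * b * K) * \<delta> (r n)))
      \<longlonglongrightarrow> I + 0\<^sup>2 + b / 2 * K * (4 * (1 + 2 * b * K) * 0)"
    by (intro tendsto_intros)
  moreover have "(\<lambda>n. energy (gibbs (U (f (r n))))) \<longlonglongrightarrow> energy (gibbs v)"
    by (rule energy_gibbs_lim[OF u v])
  ultimately have "energy (gibbs v) \<le> I"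
    using LIMSEQ_le[of _ _ _ I] by auto
  moreover have "finent (gibbs v)"
    by (rule finent_gibbs[OF potential_lim[OF u v]])
  ultimately show ?thesis
    using that I_le order_trans by metis
qed

section \<open>The fixed-point property and regularity\<close>

text \<open>An exact minimiser is a near-minimiser for every \<open>\<delta>\<close>, which forces
  the L1 distance \<open>D\<close> to its Gibbs density to be \<open>0\<close>.\<close>

lemma minimizer_fixed_point:
  assumes g: "finent g" and min: "\<And>f. finent f \<Longrightarrow> energy g \<le> energy f"
  shows "U (gibbs (U g)) = U g"
    and "energy (gibbs (U g)) \<le> energy g"
proof -
  define D where "D = (\<integral>x. \<bar>g x - gibbs (U g) x\<bar> \<partial>\<mu>)"
  note u = potential_potU[OF finent_admissible[OF g]]
  note gD = admissibleD[OF finent_admissible[OF g]]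
  note hD = admissibleD[OF finent_admissible[OF finent_gibbs[OF u]]]
  have near: "energy g \<le> energy f' + \<delta>\<^sup>2" if "finent f'" for f' \<delta>
    using min[OF that] by (smt (verit) zero_le_power2)
  define c where "c = 4 * (1 + 2 * b * K)"
  have c: "0 < c"
    using b_pos K_nonneg by (simp add: c_def add_pos_nonneg)
  have *: "D\<^sup>2 \<le> c * \<delta>" if "0 < \<delta>" "\<delta> \<le> 1" for \<delta>
    using near_minimizer(1)[OF g near that] by (simp add: D_def c_def)
  have "D\<^sup>2 \<le> 0"
  proof (rule field_le_epsilon)
    fix e :: real assume "0 < e"
    \<comment> \<open>The minimum with \<open>1\<close> respects the restriction
      \<open>\<delta> \<le> 1\<close>.\<close>
    then have "D\<^sup>2 \<le> c * min 1 (e / c)"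
      using c by (intro *) auto
    also have "\<dots> \<le> c * (e / c)"
      using c by (intro mult_left_mono) auto
    finally show "D\<^sup>2 \<le> 0 + e"
      using c by simp
  qed
  then have D: "D = 0"
    by simp
  show "energy (gibbs (U g)) \<le> energy g"
    using near_minimizer(2)[OF g near, of 1] D by (simp add: D_def)
  have "AE x in \<mu>. \<bar>g x - gibbs (U g) x\<bar> = 0"
    using D gD hD by (subst integral_nonneg_eq_0_iff_AE[symmetric]) (auto simp: D_def)
  then have "AE x in \<mu>. gibbs (U g) x = g x"
    by eventually_elim simp
  then show "U (gibbs (U g)) = U g"
    using hD(2) gD(2) by (rule potU_cong_AE)
qed

text \<open>On the nonnegative half-line \<open>exp (- x)\<close> has Lipschitz constant
  \<open>1\<close>, and \<open>b * u\<close> takes values there.\<close>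

lemma gibbs_lipschitz:
  assumes u: "potential u" and lip: "\<And>p q. \<bar>u p - u q\<bar> \<le> L * dist p q"
  shows "\<exists>C. C-lipschitz_on UNIV (gibbs u)"
proof -
  have exp_lip: "\<bar>exp (- x) - exp (- y)\<bar> \<le> \<bar>x - y\<bar>" if "0 \<le> x" "0 \<le> y" for x y :: real
  proof -
    have "exp (- s) - exp (- t) \<le> t - s" if "s \<le> t" "0 \<le> s" for s t :: real
    proof -
      have "exp (- s) * (1 - exp (- (t - s))) \<le> 1 * (t - s)"
        using that exp_ge_add_one_self[of "- (t - s)"] by (intro mult_mono; linarith?) auto
      then show ?thesis
        by (simp add: right_diff_distrib flip: exp_add)
    qed
    moreover have "exp (- t) \<le> exp (- s)" if "s \<le> t" for s t :: real
      using that by simp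
    ultimately show ?thesis
      using that by (cases "x \<le> y") (auto simp: abs_if not_le less_imp_le)
  qed
  have "(b * L / Z u)-lipschitz_on UNIV (gibbs u)"
  proof (rule lipschitz_onI)
    fix p q
    have "\<bar>exp (- b * u p) - exp (- b * u q)\<bar> \<le> \<bar>b * u p - b * u q\<bar>"
      using exp_lip[of "b * u p" "b * u q"] potentialD(2)[OF u] b_pos by simp
    also have "\<dots> = b * \<bar>u p - u q\<bar>"
      using b_pos by (simp add: abs_mult flip: right_diff_distrib)
    also have "\<dots> \<le> b * (L * dist p q)"
      using lip b_pos by (intro mult_left_mono) auto
    finally have "\<bar>exp (- b * u p) - exp (- b * u q)\<bar> / Z u \<le> b * (L * dist p q) / Z u"
      using Z_pos[OF u] by (intro divide_right_mono) auto
    then show "dist (gibbs u p) (gibbs u q) \<le> b * L / Z u * dist p q"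
      using Z_pos[OF u] by (simp add: gibbs_eq dist_real_def flip: diff_divide_distrib)
  qed (use b_pos L_pos Z_pos[OF u] in auto)
  then show ?thesis by blast
qed

end

section \<open>Minimality and the Onsager equation for the Gibbs density of a minimiser\<close>

theorem theorem1:
  fixes \<mu> :: "'a::metric_space measure"
    and k :: "'a \<Rightarrow> 'a \<Rightarrow> real"
    and L b :: real
  assumes compactM: "compact (UNIV :: 'a set)"
    and prob: "prob_space \<mu>"
    and borel: "sets \<mu> = sets borel"
    and k_nonneg: "\<And>p q. 0 \<le> k p q"
    and k_sym: "\<And>p q. k p q = k q p"
    and L_pos: "L > 0"
    and k_lip: "\<And>p q s. \<bar>k p s - k q s\<bar> \<le> L * dist p q"
    and b_pos: "b > 0"
  shows "\<exists>g. admissible \<mu> g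
            \<and> (\<forall>f. admissible \<mu> f \<longrightarrow> free_energy \<mu> k b g \<le> free_energy \<mu> k b f)
            \<and> (\<forall>p. g p > 0)
            \<and> (\<exists>C. lipschitz_on C UNIV g)
            \<and> (\<forall>p. g p = exp (- b * potU \<mu> k g p) / partition_fn \<mu> k b g)"
proof -
  interpret prob_space \<mu> by fact
  interpret onsager \<mu> k L b
    by unfold_locales fact+
  obtain g where g: "finent g" "\<And>f. finent f \<Longrightarrow> energy g \<le> energy f"
    using minimizer_exists by blast
  \<comment> \<open>The witness is \<open>h\<close>, not \<open>g\<close>: a minimiser may be
    altered on a null set, whereas positivity, the Lipschitz bound and the equation are claimed at
    every point.\<close>
  define h where "h = gibbs (U g)"
  note u = potential_potU[OF finent_admissible[OF g(1)]]
  have Uh: "U h = U g" and le: "energy h \<le> energy g"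
    unfolding h_def using minimizer_fixed_point[OF g] by simp_all
  have h: "finent h"
    unfolding h_def by (rule finent_gibbs[OF u])
  have "free_energy \<mu> k b h \<le> free_energy \<mu> k b f" if "admissible \<mu> f" for f
    using h g(2)[of f] le free_energy_eq[OF that] free_energy_eq[OF finent_admissible[OF h]]
    by (auto split: if_splits)
  \<comment> \<open>Since \<open>U h = U g\<close>, the Gibbs formula in the potential of
    \<open>g\<close> is already the equation for \<open>h\<close>.\<close>
  moreover have "h p = exp (- b * U h p) / partition_fn \<mu> k b h" for p
    unfolding partition_fn_def Uh by (simp add: h_def gibbs_def)
  moreover have "0 < h p" for p
    unfolding h_def by (rule gibbs_pos[OF u])
  moreover have "\<exists>C. C-lipschitz_on UNIV h"
    unfolding h_def
    by (rule gibbs_lipschitz[OF u potU_lip[OF finent_admissible[OF g(1)]]])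
  ultimately show ?thesis
    using finent_admissible[OF h] by blast
qed

end
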